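(* Assume $p>1$ and consider the problem $$-(|v'|^{p-2} v')' = \frac{1}{v^\gamma} \text{ in } \mathbb{R}_+,\qquad v(t)>0 \text{ in } \mathbb{R}_+,\qquad v(0)=0. \qquad ( * )$$ Let $\gamma>1$ and let $v \in C^{1,\alpha}_{\rm loc}(\mathbb{R}_+) \cap C(\overline{\mathbb{R}_+})$ be a (weak) solution to $( * )$. Then either $$v(t) \equiv v_0(t) := \left[\frac{(\gamma+p-1)^p}{p^{p-1}(p-1)(\gamma-1)}\right]^\frac{1}{\gamma+p-1} t^\frac{p}{\gamma+p-1}$$ or $$v(t) \equiv \lambda^{-\frac{p}{\gamma+p-1}} v_1(\lambda t) \quad\text{ for some } \lambda>0,$$ where $v_1$ is uniquely determined by $$\int_{0}^{v_1(t)} \left(1 + \frac{s^{1-\gamma}}{\gamma-1}\right)^{-\frac{1}{p}} ds = \left(\frac{p}{p-1}\right)^\frac{1}{p}t \quad\text{ for all } t\ge0.$$ If instead $0<\gamma\le1$, then $( * )$ has no solution in $C^{1,\alpha}_{\rm loc}(\mathbb{R}_+) \cap C(\overline{\mathbb{R}_+})$.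
   Context: $\mathbb{R}_+=(0,+\infty)$. The exponent $\alpha$ is some number in $(0,1)$. Solutions are understood weakly: $\int_0^\infty |v'|^{p-2} v' \varphi' \,dt= \int_0^\infty v^{-\gamma} \varphi\,dt$ for all $\varphi\in C^1_c(\mathbb{R}_+)$; the conditions $v>0$ and $v(0)=0$ hold pointwise. *)

theory Defs
  imports "HOL-Analysis.Analysis"
begin

text \<open>
  Functions on the open or closed half-line are represented by total functions on the reals;
  their values outside the half-line in question are never constrained.
\<close>

definition C1_holder_loc :: "real \<Rightarrow> real set \<Rightarrow> (real \<Rightarrow> real) \<Rightarrow> bool" where
  "C1_holder_loc \<alpha> S v \<longleftrightarrow>
     v C1_differentiable_on S \<and>
     (\<forall>K. compact K \<and> K \<subseteq> S \<longrightarrow>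
        (\<exists>C. \<forall>x\<in>K. \<forall>y\<in>K. \<bar>deriv v x - deriv v y\<bar> \<le> C * \<bar>x - y\<bar> powr \<alpha>))"

definition C1_compact_support :: "real set \<Rightarrow> (real \<Rightarrow> real) \<Rightarrow> bool" where
  "C1_compact_support S \<phi> \<longleftrightarrow>
     \<phi> C1_differentiable_on S \<and>
     compact (closure {t \<in> S. \<phi> t \<noteq> 0}) \<and> closure {t \<in> S. \<phi> t \<noteq> 0} \<subseteq> S"

text \<open>
  Since \<open>0 powr a = 0\<close>, the flux \<open>\<bar>v'\<bar> powr (p - 2) * v'\<close> vanishes where \<open>v'\<close> does,
  which is the right convention for every \<open>p > 1\<close>.
\<close>

definition weak_solution :: "real \<Rightarrow> real \<Rightarrow> (real \<Rightarrow> real) \<Rightarrow> bool" where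
  "weak_solution p \<gamma> v \<longleftrightarrow>
     (\<forall>\<phi>. C1_compact_support {0<..} \<phi> \<longrightarrow>
        (LBINT t:{0<..}. \<bar>deriv v t\<bar> powr (p - 2) * deriv v t * deriv \<phi> t) =
        (LBINT t:{0<..}. v t powr (- \<gamma>) * \<phi> t))"

definition singular_solution :: "real \<Rightarrow> real \<Rightarrow> real \<Rightarrow> (real \<Rightarrow> real) \<Rightarrow> bool" where
  "singular_solution \<alpha> p \<gamma> v \<longleftrightarrow>
     C1_holder_loc \<alpha> {0<..} v \<and> continuous_on {0..} v \<and>
     weak_solution p \<gamma> v \<and> (\<forall>t>0. v t > 0) \<and> v 0 = 0"

definition v0 :: "real \<Rightarrow> real \<Rightarrow> real \<Rightarrow> real" where
  "v0 p \<gamma> t =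
     ((\<gamma> + p - 1) powr p / (p powr (p - 1) * (p - 1) * (\<gamma> - 1))) powr (1 / (\<gamma> + p - 1))
       * t powr (p / (\<gamma> + p - 1))"

text \<open>
  The implicit equation for the profile only makes sense for nonnegative values, which is
  made explicit. The integrand is bounded by 1 for \<open>s > 0\<close>, and its value at \<open>s = 0\<close> is
  irrelevant to the integral.
\<close>

definition is_v1 :: "real \<Rightarrow> real \<Rightarrow> (real \<Rightarrow> real) \<Rightarrow> bool" where
  "is_v1 p \<gamma> w \<longleftrightarrow>
     (\<forall>t\<ge>0. w t \<ge> 0 \<and>
        (LBINT s:{0..w t}. (1 + s powr (1 - \<gamma>) / (\<gamma> - 1)) powr (- 1 / p)) =
        (p / (p - 1)) powr (1 / p) * t)"

end

theory Submission
  imports Defs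
begin

text \<open>
  The equation is autonomous and has one space variable, so it is integrated explicitly.
  By the du Bois-Reymond argument (\<open>weak_derivative_imp_derivative\<close>) the flux
  \<open>\<bar>v'\<bar> powr (p - 2) * v'\<close> of a weak solution is differentiable with derivative
  \<open>- (v powr - \<gamma>)\<close>, which is negative. If \<open>v'\<close> were nonpositive at one point, it would stay
  below a negative constant from some time on and \<open>v\<close> would become negative; hence
  \<open>v' > 0\<close> (\<open>deriv_solution_pos\<close>) and the flux is \<open>v' powr (p - 1)\<close>. Moreover \<open>v\<close> is
  unbounded: otherwise the positive flux would decrease at least linearly
  (\<open>solution_unbounded\<close>).

  Multiplying the equation by \<open>v'\<close> gives a conserved energy: if \<open>G\<close> is a primitive of
  \<open>s powr - \<gamma>\<close>, then \<open>(p - 1) / p * v' powr p + G v\<close> is a constant \<open>C\<close>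
  (\<open>energy_conservation\<close>). As \<open>v' > 0\<close>, this gives \<open>G v < C\<close>. For \<open>\<gamma> \<le> 1\<close> the
  primitive tends to infinity, so \<open>v\<close> would be bounded, and there is no solution. For \<open>\<gamma> > 1\<close>
  one takes \<open>G s = - (s powr (1 - \<gamma>) / (\<gamma> - 1))\<close>; unboundedness of \<open>v\<close> now forces
  \<open>C \<ge> 0\<close>, and \<open>v\<close> solves the separable equation
  \<open>v' = (p / (p - 1) * (C + v powr (1 - \<gamma>) / (\<gamma> - 1))) powr (1 / p)\<close>
  (\<open>first_order_equation\<close>).

  Separation of variables produces in each case a function of \<open>v\<close> that has constant
  derivative in \<open>t\<close> and vanishes at \<open>t = 0\<close>, hence is linear in \<open>t\<close>. For \<open>C = 0\<close> it is
  the power \<open>v powr ((\<gamma> + p - 1) / p)\<close>, which yields \<open>v0\<close>. For \<open>C > 0\<close> the scaling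
  \<open>t \<mapsto> \<mu> t\<close> normalises \<open>C\<close> to 1 and the function is the integral that defines \<open>v1\<close>;
  that integral is a bijection of the closed half-line, which also gives existence
  and uniqueness of \<open>v1\<close>.
\<close>

section \<open>From the weak to the classical equation\<close>

lemma set_lborel_integral_eq_integral_of_support:
  fixes f :: "real \<Rightarrow> real"
  assumes "continuous_on {a..b} f" "{a..b} \<subseteq> S" "\<And>x. x \<in> S \<Longrightarrow> x \<notin> {a..b} \<Longrightarrow> f x = 0"
  shows "(LBINT x:S. f x) = integral {a..b} f"
proof -
  have "(LBINT x:S. f x) = (LBINT x:{a..b}. f x)"
    unfolding set_lebesgue_integral_def
    by (rule Bochner_Integration.integral_cong)
       (use assms(2,3) in \<open>auto simp: indicator_def\<close>)
  also have "\<dots> = integral {a..b} f"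
    by (rule set_borel_integral_eq_integral(2)[OF borel_integrable_atLeastAtMost'[OF assms(1)]])
  finally show ?thesis .
qed

lemma continuous_antiderivative_half_line:
  fixes g :: "real \<Rightarrow> real"
  assumes "continuous_on {0<..} g"
  obtains G where "\<And>t. t > 0 \<Longrightarrow> (G has_real_derivative g t) (at t)"
proof -
  have "\<exists>F. \<forall>x. (0::ereal) < ereal x \<longrightarrow> ereal x < \<infinity> \<longrightarrow> (F has_vector_derivative g x) (at x)"
    by (rule einterval_antiderivative)
       (use assms in \<open>auto simp: continuous_on_eq_continuous_at zero_ereal_def\<close>)
  then show ?thesis
    using that by (auto simp: zero_ereal_def has_real_derivative_iff_has_vector_derivative)
qed

text \<open>
  A test function on the half-line must have a derivative of integral zero. The difference of
  two translates of one bump has this property, because a primitive of the bump is constant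
  on either side of its support; the integral of the bump is never computed.
\<close>

lemma bump_difference_test_function:
  fixes s t \<epsilon> :: real
  assumes \<epsilon>: "0 < \<epsilon>" "\<epsilon> < s" "\<epsilon> < t"
  defines "\<psi> \<equiv> \<lambda>x. max 0 (\<epsilon> - \<bar>x - s\<bar>) - max 0 (\<epsilon> - \<bar>x - t\<bar>)"
  obtains \<phi> where "\<And>x. (\<phi> has_real_derivative \<psi> x) (at x)"
    "\<And>x. x \<le> min s t - \<epsilon> \<Longrightarrow> \<phi> x = 0" "\<And>x. x \<ge> max s t + \<epsilon> \<Longrightarrow> \<phi> x = 0"
    "C1_compact_support {0<..} \<phi>"
proof -
  let ?b = "\<lambda>x. max 0 (\<epsilon> - \<bar>x\<bar>)"
  have "\<exists>F. \<forall>x. -\<infinity> < ereal x \<longrightarrow> ereal x < \<infinity> \<longrightarrow> (F has_vector_derivative ?b x) (at x)"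
    by (rule einterval_antiderivative) (auto intro!: continuous_intros)
  then obtain F where F: "\<And>x. (F has_real_derivative ?b x) (at x)"
    by (auto simp: has_real_derivative_iff_has_vector_derivative)
  have "\<exists>c. \<forall>x\<in>{..-\<epsilon>}. F x = c"
    by (rule has_field_derivative_zero_constant)
       (auto intro!: DERIV_subset[OF F, THEN DERIV_cong])
  then obtain c0 where c0: "\<And>x. x \<le> -\<epsilon> \<Longrightarrow> F x = c0" by auto
  have "\<exists>c. \<forall>x\<in>{\<epsilon>..}. F x = c"
    by (rule has_field_derivative_zero_constant)
       (auto intro!: DERIV_subset[OF F, THEN DERIV_cong])
  then obtain c1 where c1: "\<And>x. x \<ge> \<epsilon> \<Longrightarrow> F x = c1" by auto
  define \<phi> where "\<phi> = (\<lambda>x. F (x - s) - F (x - t))"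
  have d: "(\<phi> has_real_derivative \<psi> x) (at x)" for x
    unfolding \<phi>_def \<psi>_def
    by (auto intro!: derivative_eq_intros DERIV_chain2[OF F])
  have l: "\<phi> x = 0" if "x \<le> min s t - \<epsilon>" for x
    using that by (simp add: \<phi>_def c0)
  have r: "\<phi> x = 0" if "x \<ge> max s t + \<epsilon>" for x
    using that by (simp add: \<phi>_def c1)
  let ?I = "{min s t - \<epsilon>..max s t + \<epsilon>}"
  have sub: "closure {x \<in> {0<..}. \<phi> x \<noteq> 0} \<subseteq> ?I"
  proof (rule closure_minimal)
    show "{x \<in> {0<..}. \<phi> x \<noteq> 0} \<subseteq> ?I"
    proof
      fix x assume "x \<in> {x \<in> {0<..}. \<phi> x \<noteq> 0}"
      then show "x \<in> ?I" using l[of x] r[of x] by fastforce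
    qed
  qed simp
  have "compact (closure {x \<in> {0<..}. \<phi> x \<noteq> 0})"
    using sub bounded_subset[OF bounded_closed_interval sub] by (simp add: compact_eq_bounded_closed)
  moreover have "closure {x \<in> {0<..}. \<phi> x \<noteq> 0} \<subseteq> {0<..}"
    using sub \<epsilon> by (auto dest!: subsetD)
  moreover have "continuous_on {0<..} \<psi>"
    unfolding \<psi>_def by (intro continuous_intros)
  then have "\<phi> C1_differentiable_on {0<..}"
    unfolding C1_differentiable_on_def
    using d by (auto simp: has_real_derivative_iff_has_vector_derivative)
  ultimately have "C1_compact_support {0<..} \<phi>"
    by (simp add: C1_compact_support_def)
  then show ?thesis using that d l r by blast
qed

text \<open>
  With \<open>G\<close> a primitive of \<open>g\<close>, integration by parts turns the weak equation into the statement
  that \<open>f + G\<close> is orthogonal to the derivatives of all test functions. Such a function is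
  constant: if it were larger near \<open>s\<close> than some \<open>m\<close> and smaller than \<open>m\<close> near \<open>t\<close>, then a
  positive bump at \<open>s\<close> and a negative one at \<open>t\<close> would make the integrand
  \<open>(f + G - m) * \<phi>'\<close> nonnegative and not identically zero.
\<close>

lemma weak_derivative_imp_derivative:
  fixes f g :: "real \<Rightarrow> real"
  assumes cf: "continuous_on {0<..} f" and cg: "continuous_on {0<..} g"
    and weak: "\<And>\<phi>. C1_compact_support {0<..} \<phi> \<Longrightarrow>
          (LBINT t:{0<..}. f t * deriv \<phi> t) = (LBINT t:{0<..}. g t * \<phi> t)"
    and "t > 0"
  shows "(f has_real_derivative - g t) (at t)"
proof -
  obtain G where G: "\<And>t. t > 0 \<Longrightarrow> (G has_real_derivative g t) (at t)"
    using continuous_antiderivative_half_line[OF cg] by blast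
  define h where "h = (\<lambda>x. f x + G x)"
  have cG: "continuous_on {0<..} G"
    using G by (intro continuous_at_imp_continuous_on ballI) (auto intro: DERIV_isCont)
  have ch: "continuous_on {0<..} h"
    unfolding h_def by (intro continuous_intros cf cG)
  have le: "h s \<le> h t" if st: "s > 0" "t > 0" for s t
  proof (rule ccontr)
    assume "\<not> h s \<le> h t"
    then obtain m where m: "h t < m" "m < h s" using dense not_le by metis
    have "isCont h s" "isCont h t"
      using ch st by (auto simp: continuous_on_eq_continuous_at)
    then have "\<forall>\<^sub>F x in nhds s. h x > m" "\<forall>\<^sub>F x in nhds t. h x < m"
      using m by (auto simp: isCont_def tendsto_at_iff_tendsto_nhds dest: order_tendstoD)
    then obtain d1 d2 where d: "d1 > 0" "d2 > 0"
      "\<And>x. \<bar>x - s\<bar> < d1 \<Longrightarrow> h x > m" "\<And>x. \<bar>x - t\<bar> < d2 \<Longrightarrow> h x < m"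
      unfolding eventually_nhds_metric dist_real_def by metis
    \<comment> \<open>The halves keep the supports of both bumps away from the boundary point 0.\<close>
    define \<epsilon> where "\<epsilon> = Min {d1, d2, s/2, t/2}"
    have \<epsilon>: "0 < \<epsilon>" "\<epsilon> < s" "\<epsilon> < t" "\<epsilon> \<le> d1" "\<epsilon> \<le> d2"
      using st d(1,2) by (auto simp: \<epsilon>_def min_def)
    define \<psi> where "\<psi> = (\<lambda>x. max 0 (\<epsilon> - \<bar>x - s\<bar>) - max 0 (\<epsilon> - \<bar>x - t\<bar>))"
    obtain \<phi> where \<phi>: "\<And>x. (\<phi> has_real_derivative \<psi> x) (at x)"
      "\<And>x. x \<le> min s t - \<epsilon> \<Longrightarrow> \<phi> x = 0" "\<And>x. x \<ge> max s t + \<epsilon> \<Longrightarrow> \<phi> x = 0"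
      "C1_compact_support {0<..} \<phi>"
      using bump_difference_test_function[OF \<epsilon>(1-3)] unfolding \<psi>_def by metis
    define A B where "A = min s t - \<epsilon>" and "B = max s t + \<epsilon>"
    have AB: "0 < A" "A \<le> B" "A < s" "s < B" using \<epsilon> by (auto simp: A_def B_def)
    have sub: "{A..B} \<subseteq> {0<..}" using AB by auto
    have c\<psi>: "continuous_on X \<psi>" for X unfolding \<psi>_def by (intro continuous_intros)
    have c\<phi>: "continuous_on X \<phi>" for X
      using \<phi>(1) by (intro continuous_at_imp_continuous_on ballI) (auto intro: DERIV_isCont)
    note cont = continuous_on_subset[OF cf sub] continuous_on_subset[OF cg sub]
      continuous_on_subset[OF cG sub] continuous_on_subset[OF ch sub] c\<psi> c\<phi>
    have outside: "\<psi> x = 0" "\<phi> x = 0" if "x \<notin> {A..B}" for x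
      using that \<phi>(2,3)[of x] by (auto simp: \<psi>_def A_def B_def)
    have deriv: "deriv \<phi> x = \<psi> x" for x using \<phi>(1) by (rule DERIV_imp_deriv)
    have "integral {A..B} (\<lambda>x. f x * \<psi> x) = (LBINT x:{0<..}. f x * deriv \<phi> x)"
      unfolding deriv
      by (rule set_lborel_integral_eq_integral_of_support[symmetric, OF _ sub])
         (auto intro!: continuous_intros cont outside)
    also have "\<dots> = (LBINT x:{0<..}. g x * \<phi> x)" by (rule weak[OF \<phi>(4)])
    also have "\<dots> = integral {A..B} (\<lambda>x. g x * \<phi> x)"
      by (rule set_lborel_integral_eq_integral_of_support[OF _ sub])
         (auto intro!: continuous_intros cont outside)
    finally have eq: "integral {A..B} (\<lambda>x. f x * \<psi> x) = integral {A..B} (\<lambda>x. g x * \<phi> x)" .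
    have ftc: "((\<lambda>x. g x * \<phi> x + (G x - m) * \<psi> x) has_integral
                 (G B - m) * \<phi> B - (G A - m) * \<phi> A) {A..B}"
      using AB
      by (intro fundamental_theorem_of_calculus)
         (auto simp flip: has_real_derivative_iff_has_vector_derivative
           intro!: derivative_eq_intros DERIV_subset[OF G] DERIV_subset[OF \<phi>(1)])
    have "integral {A..B} (\<lambda>x. g x * \<phi> x + (G x - m) * \<psi> x) = 0"
      using integral_unique[OF ftc] \<phi>(2,3) by (simp add: A_def B_def)
    moreover have "integral {A..B} (\<lambda>x. g x * \<phi> x + (G x - m) * \<psi> x) =
        integral {A..B} (\<lambda>x. g x * \<phi> x) + integral {A..B} (\<lambda>x. (G x - m) * \<psi> x)"
      by (intro Henstock_Kurzweil_Integration.integral_add integrable_continuous_real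
          continuous_intros cont)
    moreover have "integral {A..B} (\<lambda>x. (h x - m) * \<psi> x) =
        integral {A..B} (\<lambda>x. f x * \<psi> x) + integral {A..B} (\<lambda>x. (G x - m) * \<psi> x)"
      unfolding h_def
      by (subst Henstock_Kurzweil_Integration.integral_add[symmetric])
         (auto intro!: integrable_continuous_real continuous_intros cont simp: algebra_simps)
    ultimately have zero: "integral {A..B} (\<lambda>x. (h x - m) * \<psi> x) = 0"
      using eq by simp
    have "(h x - m) * \<psi> x \<ge> 0" for x
    proof -
      consider "\<bar>x - s\<bar> < \<epsilon>" | "\<bar>x - s\<bar> \<ge> \<epsilon>" "\<bar>x - t\<bar> < \<epsilon>" | "\<bar>x - s\<bar> \<ge> \<epsilon>" "\<bar>x - t\<bar> \<ge> \<epsilon>"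
        by linarith
      then show ?thesis
      proof cases
        case 1
        then have "h x > m" using d(3) \<epsilon> by force
        moreover from this have "\<bar>x - t\<bar> \<ge> \<epsilon>" using d(4)[of x] \<epsilon> by force
        ultimately show ?thesis using 1 by (simp add: \<psi>_def)
      next
        case 2
        then have "h x < m" using d(4) \<epsilon> by force
        then show ?thesis using 2 by (simp add: \<psi>_def mult_nonpos_nonpos)
      qed (simp add: \<psi>_def)
    qed
    moreover have "continuous_on {A..B} (\<lambda>x. (h x - m) * \<psi> x)"
      by (intro continuous_intros cont)
    ultimately have "\<forall>x\<in>{A..B}. (h x - m) * \<psi> x = 0"
      using zero AB by (subst (asm) integral_eq_0_iff) auto
    then have "(h s - m) * \<psi> s = 0" using AB by auto
    moreover have "\<bar>s - t\<bar> \<ge> \<epsilon>" using d(4)[of s] m \<epsilon> by force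
    ultimately show False using m \<epsilon> by (simp add: \<psi>_def)
  qed
  have "h x = h 1" if "x > 0" for x
    using le[OF that zero_less_one] le[OF zero_less_one that] by simp
  then have f_eq: "f x = h 1 - G x" if "x > 0" for x
    using that unfolding h_def by (metis add_diff_cancel_right')
  have "((\<lambda>x. h 1 - G x) has_real_derivative - g t) (at t)"
    using G[OF \<open>t > 0\<close>] by (auto intro!: derivative_eq_intros)
  then show ?thesis
    by (rule has_field_derivative_transform_within_open[of _ _ _ "{0<..}"])
       (use f_eq \<open>t > 0\<close> in auto)
qed

section \<open>Positivity, unboundedness and the energy\<close>

lemma eventually_neg_of_deriv_bounded_away:
  fixes f f' :: "real \<Rightarrow> real"
  assumes "\<And>t. t \<ge> a \<Longrightarrow> (f has_real_derivative f' t) (at t)" "\<And>t. t \<ge> a \<Longrightarrow> f' t \<le> - d" "d > 0"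
  obtains t where "t \<ge> a" "f t < 0"
proof -
  define t where "t = a + (\<bar>f a\<bar> + 1) / d"
  have "t > a" using \<open>d > 0\<close> by (simp add: t_def add_pos_nonneg)
  have "f t + d * t \<le> f a + d * a"
    by (rule DERIV_nonpos_imp_nonincreasing[where f="\<lambda>x. f x + d * x"])
       (use \<open>t > a\<close> assms(1,2) in \<open>force intro!: exI derivative_eq_intros\<close>)+
  moreover have "d * t = d * a + \<bar>f a\<bar> + 1" using \<open>d > 0\<close> by (simp add: t_def field_simps)
  ultimately show ?thesis using that[of t] \<open>t > a\<close> by auto
qed

lemma linear_of_constant_derivative:
  fixes f :: "real \<Rightarrow> real"
  assumes "continuous_on {0..} f" "f 0 = 0" "\<And>t. t > 0 \<Longrightarrow> (f has_real_derivative k) (at t)" "t \<ge> 0"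
  shows "f t = k * t"
proof (cases "t = 0")
  case False
  with \<open>t \<ge> 0\<close> have "t > 0" by simp
  then have "f t - k * t = f 0 - k * 0"
    by (rule DERIV_isconst_end)
       (use assms(1,3) in \<open>auto intro!: derivative_eq_intros continuous_intros
          intro: continuous_on_subset\<close>)
  then show ?thesis using assms(2) by simp
qed (use assms in simp)


context
  fixes p \<gamma> \<alpha> :: real and v :: "real \<Rightarrow> real"
  assumes p: "p > 1" and \<gamma>: "\<gamma> > 0" and sol: "singular_solution \<alpha> p \<gamma> v"
begin

lemma solution_pos: "t > 0 \<Longrightarrow> v t > 0"
  using sol by (simp add: singular_solution_def)

lemma solution_continuous: "continuous_on {0..} v"
  using sol by (simp add: singular_solution_def)

lemma
  shows solution_deriv: "t > 0 \<Longrightarrow> (v has_real_derivative deriv v t) (at t)"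
    and continuous_deriv: "continuous_on {0<..} (deriv v)"
proof -
  obtain D where D: "\<And>t. t > 0 \<Longrightarrow> (v has_real_derivative D t) (at t)" "continuous_on {0<..} D"
    using sol unfolding singular_solution_def C1_holder_loc_def C1_differentiable_on_def
      has_real_derivative_iff_has_vector_derivative by force
  have eq: "deriv v t = D t" if "t > 0" for t
    using D(1)[OF that] by (rule DERIV_imp_deriv)
  show "t > 0 \<Longrightarrow> (v has_real_derivative deriv v t) (at t)" using D(1) eq by simp
  show "continuous_on {0<..} (deriv v)"
    using D(2) by (rule continuous_on_eq) (simp add: eq)
qed

lemma flux_deriv:
  assumes "t > 0"
  shows "((\<lambda>t. \<bar>deriv v t\<bar> powr (p - 2) * deriv v t) has_real_derivative - (v t powr - \<gamma>)) (at t)"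
proof (rule weak_derivative_imp_derivative[OF _ _ _ assms])
  \<comment> \<open>For \<open>p < 2\<close> the factor \<open>\<bar>x\<bar> powr (p - 2)\<close> blows up at 0; the flux is written as a
     combination of positive powers to see that it is continuous there.\<close>
  have flux: "\<bar>x\<bar> powr (p - 2) * x = max 0 x powr (p - 1) - max 0 (- x) powr (p - 1)" for x :: real
    using powr_mult_base[of "\<bar>x\<bar>" "p - 2"] p by (cases "x \<ge> 0") (auto simp: mult.commute max_def)
  show "continuous_on {0<..} (\<lambda>t. \<bar>deriv v t\<bar> powr (p - 2) * deriv v t)"
    unfolding flux using p by (intro continuous_intros continuous_deriv continuous_on_powr') auto
  show "continuous_on {0<..} (\<lambda>t. v t powr - \<gamma>)"
    by (intro continuous_on_powr continuous_on_const
        continuous_on_subset[OF solution_continuous]) (use solution_pos in force)+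
qed (use sol in \<open>auto simp: singular_solution_def weak_solution_def\<close>)

text \<open>
  A positive concave function on a half-line cannot decrease anywhere. Concavity is expressed
  through the flux, which is strictly decreasing: a value \<open>- m < 0\<close> of the flux at \<open>t + 1\<close>
  bounds \<open>v'\<close> above by \<open>- (m powr (1 / (p - 1)))\<close> from then on.
\<close>

lemma deriv_solution_pos:
  assumes "t > 0"
  shows "deriv v t > 0"
proof (rule ccontr)
  let ?w = "\<lambda>t. \<bar>deriv v t\<bar> powr (p - 2) * deriv v t"
  assume "\<not> deriv v t > 0"
  then have "?w t \<le> 0" by (simp add: mult_nonneg_nonpos)
  have dec: "?w y < ?w x" if "0 < x" "x < y" for x y
  proof (rule DERIV_neg_imp_decreasing[OF \<open>x < y\<close>])
    fix z assume "x \<le> z" "z \<le> y"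
    with that have "z > 0" by simp
    then show "\<exists>d. (?w has_real_derivative d) (at z) \<and> d < 0"
      using flux_deriv solution_pos by (metis neg_less_0_iff_less powr_gt_zero less_numeral_extra(3))
  qed
  define m where "m = - ?w (t + 1)"
  have "m > 0" using dec[of t "t + 1"] \<open>?w t \<le> 0\<close> \<open>t > 0\<close> by (simp add: m_def)
  have "deriv v s \<le> - (m powr (1 / (p - 1)))" if "s \<ge> t + 1" for s
  proof -
    have "?w s \<le> - m"
      using dec[of "t + 1" s] that \<open>t > 0\<close> by (cases "s = t + 1") (auto simp: m_def)
    then have "deriv v s < 0"
      using \<open>m > 0\<close> by (smt (verit) mult_nonneg_nonneg powr_ge_zero)
    then have "?w s = - ((- deriv v s) powr (p - 1))"
      using powr_mult_base[of "- deriv v s" "p - 2"] by (simp add: mult.commute)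
    then have "m \<le> (- deriv v s) powr (p - 1)" using \<open>?w s \<le> - m\<close> by simp
    then have "m powr (1 / (p - 1)) \<le> ((- deriv v s) powr (p - 1)) powr (1 / (p - 1))"
      using \<open>m > 0\<close> p by (intro powr_mono2) auto
    then show ?thesis using p \<open>deriv v s < 0\<close> by (simp add: powr_powr)
  qed
  then obtain s where "s \<ge> t + 1" "v s < 0"
    using eventually_neg_of_deriv_bounded_away[of "t + 1" v "deriv v" "m powr (1 / (p - 1))"]
      solution_deriv \<open>t > 0\<close> \<open>m > 0\<close> by force
  then show False using solution_pos[of s] \<open>t > 0\<close> by simp
qed

lemma flux_deriv_powr:
  assumes "t > 0"
  shows "((\<lambda>t. deriv v t powr (p - 1)) has_real_derivative - (v t powr - \<gamma>)) (at t)"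
  using flux_deriv[OF assms]
proof (rule has_field_derivative_transform_within_open[of _ _ _ "{0<..}"])
  fix s :: real assume "s \<in> {0<..}"
  then show "\<bar>deriv v s\<bar> powr (p - 2) * deriv v s = deriv v s powr (p - 1)"
    using deriv_solution_pos[of s] powr_mult_base[of "deriv v s" "p - 2"] by (simp add: mult.commute)
qed (use assms in auto)

text \<open>
  If \<open>v \<le> M\<close>, then the flux has slope at most \<open>- (M powr - \<gamma>)\<close>, since \<open>\<gamma> > 0\<close>, and
  becomes negative, although \<open>v' powr (p - 1)\<close> is nonnegative.
\<close>

lemma solution_unbounded: "\<exists>t>0. v t > M"
proof (rule ccontr)
  assume "\<not> (\<exists>t>0. v t > M)"
  then have M: "v t \<le> M" if "t > 0" for t using that by (meson not_less)
  then have "M > 0" using solution_pos[of 1] M[of 1] by linarith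
  have "- (v t powr - \<gamma>) \<le> - (M powr - \<gamma>)" if "t \<ge> 1" for t
    using M[of t] solution_pos[of t] that \<gamma> by (simp add: powr_mono2')
  then obtain t where "t \<ge> 1" "deriv v t powr (p - 1) < 0"
    using eventually_neg_of_deriv_bounded_away[of 1 "\<lambda>t. deriv v t powr (p - 1)"
        "\<lambda>t. - (v t powr - \<gamma>)" "M powr - \<gamma>"] flux_deriv_powr \<open>M > 0\<close> by force
  then show False by (simp add: not_less[symmetric])
qed

text \<open>
  The derivative \<open>v'\<close> is not known to be differentiable, only the flux is. The kinetic term is
  therefore differentiated in the form \<open>(v' powr (p - 1)) powr (p / (p - 1))\<close>.
\<close>

lemma energy_conservation:
  assumes G: "\<And>s. s > 0 \<Longrightarrow> (G has_real_derivative s powr - \<gamma>) (at s)"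
  obtains C where "\<And>t. t > 0 \<Longrightarrow> (p - 1) / p * deriv v t powr p + G (v t) = C"
proof -
  have *: "((\<lambda>t. (p - 1) / p * (deriv v t powr (p - 1)) powr (p / (p - 1)) + G (v t))
          has_real_derivative 0) (at t)" if "t > 0" for t
  proof -
    have pos: "deriv v t > 0" "v t > 0" using that deriv_solution_pos solution_pos by auto
    have "(p - 1) / p * (p / (p - 1) * (deriv v t powr (p - 1)) powr (p / (p - 1) - 1) *
            - (v t powr - \<gamma>)) + v t powr - \<gamma> * deriv v t = 0"
    proof -
      have "(p - 1) * (p / (p - 1) - 1) = 1" using p by (simp add: field_simps)
      then have "(deriv v t powr (p - 1)) powr (p / (p - 1) - 1) = deriv v t"
        using pos by (simp add: powr_powr)
      then show ?thesis using p by simp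
    qed
    moreover have "((\<lambda>t. (p - 1) / p * (deriv v t powr (p - 1)) powr (p / (p - 1)) + G (v t))
       has_real_derivative (p - 1) / p * (p / (p - 1) * (deriv v t powr (p - 1)) powr (p / (p - 1) - 1) *
            - (v t powr - \<gamma>)) + v t powr - \<gamma> * deriv v t) (at t)"
      using pos that
      by (intro DERIV_add DERIV_cmult DERIV_chain2[OF G] solution_deriv
           DERIV_chain2[OF has_real_derivative_powr] flux_deriv_powr) auto
    ultimately show ?thesis by simp
  qed
  have "\<exists>C. \<forall>t\<in>{0<..}. (p - 1) / p * (deriv v t powr (p - 1)) powr (p / (p - 1)) + G (v t) = C"
    by (rule has_field_derivative_zero_constant) (use * in \<open>auto intro: DERIV_subset\<close>)
  then show ?thesis using that p by (auto simp: powr_powr)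
qed

text \<open>
  For \<open>\<gamma> \<le> 1\<close> the potential \<open>G\<close> is increasing and unbounded above, so the energy bound
  \<open>G v < C\<close> contradicts unboundedness of \<open>v\<close>.
\<close>

lemma no_solution_of_exponent_le_1:
  assumes "\<gamma> \<le> 1"
  shows False
proof -
  define G :: "real \<Rightarrow> real" where
    "G = (if \<gamma> = 1 then ln else (\<lambda>s. s powr (1 - \<gamma>) / (1 - \<gamma>)))"
  have "(G has_real_derivative s powr - \<gamma>) (at s)" if "s > 0" for s
    using that unfolding G_def
    by (auto intro!: derivative_eq_intros simp: powr_minus divide_simps)
  then obtain C where C: "\<And>t. t > 0 \<Longrightarrow> (p - 1) / p * deriv v t powr p + G (v t) = C"
    using energy_conservation by metis
  have less: "G (v t) < C" if "t > 0" for t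
    using C[OF that] deriv_solution_pos[OF that] p
    by (smt (verit) divide_pos_pos mult_pos_pos powr_gt_zero)
  have "\<exists>M. \<forall>t>0. v t \<le> M"
  proof (cases "\<gamma> = 1")
    case True
    have "v t \<le> exp C" if "t > 0" for t
    proof -
      have "exp (ln (v t)) < exp C" using less[OF that] True by (simp add: G_def)
      then show ?thesis using solution_pos[OF that] by simp
    qed
    then show ?thesis by blast
  next
    case False
    have "v t \<le> ((1 - \<gamma>) * C) powr (1 / (1 - \<gamma>))" if "t > 0" for t
    proof -
      have "v t powr (1 - \<gamma>) \<le> (1 - \<gamma>) * C"
        using less[OF that] False assms by (simp add: G_def field_simps)
      then have "(v t powr (1 - \<gamma>)) powr (1 / (1 - \<gamma>)) \<le> ((1 - \<gamma>) * C) powr (1 / (1 - \<gamma>))"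
        using assms by (intro powr_mono2) auto
      then show ?thesis using solution_pos[OF that] False by (simp add: powr_powr)
    qed
    then show ?thesis by blast
  qed
  then show False using solution_unbounded by (meson not_le)
qed

text \<open>
  For \<open>\<gamma> > 1\<close> the potential is negative and tends to 0 at infinity. With \<open>C < 0\<close> the solution
  would be confined to the bounded region where \<open>v powr (1 - \<gamma>) / (\<gamma> - 1) \<ge> - C\<close>.
\<close>

lemma first_order_equation:
  assumes "\<gamma> > 1"
  obtains C where "C \<ge> 0"
    "\<And>t. t > 0 \<Longrightarrow> deriv v t = (p / (p - 1) * (C + v t powr (1 - \<gamma>) / (\<gamma> - 1))) powr (1 / p)"
proof -
  have "((\<lambda>s. - (s powr (1 - \<gamma>) / (\<gamma> - 1))) has_real_derivative s powr - \<gamma>) (at s)" if "s > 0" for s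
    using that assms by (auto intro!: derivative_eq_intros simp: divide_simps) (simp add: algebra_simps)
  then obtain C where "\<And>t. t > 0 \<Longrightarrow>
      (p - 1) / p * deriv v t powr p + - (v t powr (1 - \<gamma>) / (\<gamma> - 1)) = C"
    using energy_conservation by blast
  then have C: "(p - 1) / p * deriv v t powr p = C + v t powr (1 - \<gamma>) / (\<gamma> - 1)" if "t > 0" for t
    using that by (smt (verit))
  have "C \<ge> 0"
  proof (rule ccontr)
    assume "\<not> C \<ge> 0"
    have "v t \<le> ((\<gamma> - 1) * - C) powr (1 / (1 - \<gamma>))" if "t > 0" for t
    proof -
      have "(p - 1) / p * deriv v t powr p \<ge> 0" using p by simp
      then have "C + v t powr (1 - \<gamma>) / (\<gamma> - 1) \<ge> 0" using C[OF that] by simp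
      then have "(\<gamma> - 1) * - C \<le> v t powr (1 - \<gamma>)"
        using assms by (simp add: field_simps)
      then have "(v t powr (1 - \<gamma>)) powr (1 / (1 - \<gamma>)) \<le> ((\<gamma> - 1) * - C) powr (1 / (1 - \<gamma>))"
        using assms \<open>\<not> C \<ge> 0\<close> by (intro powr_mono2') (auto simp: divide_nonpos_nonpos mult_pos_neg)
      then show ?thesis using solution_pos[OF that] assms by (simp add: powr_powr)
    qed
    then show False using solution_unbounded by (meson not_le)
  qed
  moreover have "deriv v t = (p / (p - 1) * (C + v t powr (1 - \<gamma>) / (\<gamma> - 1))) powr (1 / p)"
    if "t > 0" for t
  proof -
    have "p / (p - 1) * (C + v t powr (1 - \<gamma>) / (\<gamma> - 1)) = deriv v t powr p"
      using p by (simp add: C[OF that, symmetric])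
    then show ?thesis using deriv_solution_pos[OF that] p by (simp add: powr_powr)
  qed
  ultimately show ?thesis using that by blast
qed

end


section \<open>The integral defining the profile\<close>

definition profile_integral :: "real \<Rightarrow> real \<Rightarrow> real \<Rightarrow> real" where
  "profile_integral p \<gamma> x = (LBINT s:{0..x}. (1 + s powr (1 - \<gamma>) / (\<gamma> - 1)) powr (- 1 / p))"

context
  fixes p \<gamma> :: real
  assumes p: "p > 1" and \<gamma>: "\<gamma> > 1"
begin

text \<open>
  Since \<open>0 powr (1 - \<gamma>) = 0\<close>, the integrand of \<open>profile_integral\<close> has the value 1 at \<open>s = 0\<close>,
  whereas its limit there is 0. The following form agrees with it for \<open>s > 0\<close> and is
  continuous up to 0, so that the fundamental theorem of calculus applies on the closed
  half-line.
\<close>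

lemma continuous_profile_integrand:
  "continuous_on {0..} (\<lambda>s. (s powr (\<gamma> - 1) / (s powr (\<gamma> - 1) + 1 / (\<gamma> - 1))) powr (1 / p))"
  using p \<gamma>
  by (intro continuous_on_powr' continuous_intros) (auto simp: add_nonneg_eq_0_iff)

lemma profile_integrand_eq:
  assumes "s > 0"
  shows "(s powr (\<gamma> - 1) / (s powr (\<gamma> - 1) + 1 / (\<gamma> - 1))) powr (1 / p) =
         (1 + s powr (1 - \<gamma>) / (\<gamma> - 1)) powr (- 1 / p)"
proof -
  have pos: "1 + s powr (1 - \<gamma>) / (\<gamma> - 1) > 0" using \<gamma> by (intro add_pos_nonneg) auto
  have "s powr (1 - \<gamma>) = inverse (s powr (\<gamma> - 1))"
    using powr_minus[of s "\<gamma> - 1"] by simp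
  moreover have "a / (a + 1 / g) = inverse (1 + inverse a / g)" if "a > 0" "g > 0" for a g :: real
    using that by (simp add: field_simps)
  ultimately have "s powr (\<gamma> - 1) / (s powr (\<gamma> - 1) + 1 / (\<gamma> - 1)) =
      inverse (1 + s powr (1 - \<gamma>) / (\<gamma> - 1))"
    using assms \<gamma> by simp
  then show ?thesis using pos by (simp add: powr_minus inverse_powr)
qed

lemma profile_integral_eq:
  assumes "x \<ge> 0"
  shows "profile_integral p \<gamma> x =
    integral {0..x} (\<lambda>s. (s powr (\<gamma> - 1) / (s powr (\<gamma> - 1) + 1 / (\<gamma> - 1))) powr (1 / p))"
proof -
  have "profile_integral p \<gamma> x =
    (LBINT s:{0..x}. (s powr (\<gamma> - 1) / (s powr (\<gamma> - 1) + 1 / (\<gamma> - 1))) powr (1 / p))"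
    unfolding profile_integral_def
  proof (rule set_lebesgue_integral_cong_AE)
    show "AE s\<in>{0..x} in lborel. (1 + s powr (1 - \<gamma>) / (\<gamma> - 1)) powr (- 1 / p) =
        (s powr (\<gamma> - 1) / (s powr (\<gamma> - 1) + 1 / (\<gamma> - 1))) powr (1 / p)"
      using AE_lborel_singleton[of 0]
      by eventually_elim (auto simp: profile_integrand_eq)
  qed measurable
  also have "\<dots> = integral {0..x} (\<lambda>s. (s powr (\<gamma> - 1) / (s powr (\<gamma> - 1) + 1 / (\<gamma> - 1))) powr (1 / p))"
    by (rule set_lborel_integral_eq_integral_of_support)
       (auto intro: continuous_on_subset[OF continuous_profile_integrand])
  finally show ?thesis .
qed

lemma profile_integral_has_derivative_within:
  assumes "x \<ge> 0"
  shows "(profile_integral p \<gamma> has_real_derivative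
      (x powr (\<gamma> - 1) / (x powr (\<gamma> - 1) + 1 / (\<gamma> - 1))) powr (1 / p)) (at x within {0..})"
proof -
  have "((\<lambda>x. integral {0..x} (\<lambda>s. (s powr (\<gamma> - 1) / (s powr (\<gamma> - 1) + 1 / (\<gamma> - 1))) powr (1 / p)))
     has_real_derivative (x powr (\<gamma> - 1) / (x powr (\<gamma> - 1) + 1 / (\<gamma> - 1))) powr (1 / p))
       (at x within {0..x + 1})"
    by (rule integral_has_real_derivative)
       (use assms in \<open>auto intro: continuous_on_subset[OF continuous_profile_integrand]\<close>)
  also have "at x within {0..x + 1} = at x within {0..}"
    by (rule at_within_nhd[of _ "{..<x + 1}"]) auto
  finally show ?thesis
    by (rule has_field_derivative_transform_within[OF _ zero_less_one]) (use assms profile_integral_eq in auto)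
qed

lemma profile_integral_0: "profile_integral p \<gamma> 0 = 0"
  by (simp add: profile_integral_eq)

lemma continuous_profile_integral: "continuous_on {0..} (profile_integral p \<gamma>)"
  using profile_integral_has_derivative_within by (intro DERIV_continuous_on) auto

lemma profile_integral_deriv:
  assumes "x > 0"
  shows "(profile_integral p \<gamma> has_real_derivative
            (1 + x powr (1 - \<gamma>) / (\<gamma> - 1)) powr (- 1 / p)) (at x)"
proof -
  have "(profile_integral p \<gamma> has_real_derivative
            (1 + x powr (1 - \<gamma>) / (\<gamma> - 1)) powr (- 1 / p)) (at x within {0<..})"
    using DERIV_subset[OF profile_integral_has_derivative_within, of x "{0<..}"] assms
    by (simp add: profile_integrand_eq subset_eq)
  then show ?thesis using assms at_within_open[of x "{0<..}"] by simp
qed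

lemma profile_integral_strict_mono: "strict_mono_on {0..} (profile_integral p \<gamma>)"
proof (rule strict_mono_onI)
  fix x y :: real assume "x \<in> {0..}" "x < y"
  show "profile_integral p \<gamma> x < profile_integral p \<gamma> y"
  proof (rule DERIV_pos_imp_increasing_open[OF \<open>x < y\<close>])
    fix z assume "x < z" "z < y"
    moreover have "1 + z powr (1 - \<gamma>) / (\<gamma> - 1) > 0" using \<gamma> by (intro add_pos_nonneg) auto
    ultimately show "\<exists>d. (profile_integral p \<gamma> has_real_derivative d) (at z) \<and> d > 0"
      using \<open>x \<in> {0..}\<close>
      by (intro exI[of _ "(1 + z powr (1 - \<gamma>) / (\<gamma> - 1)) powr (- 1 / p)"] conjI profile_integral_deriv) auto
  qed (use \<open>x \<in> {0..}\<close> in \<open>auto intro: continuous_on_subset[OF continuous_profile_integral]\<close>)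
qed

text \<open>
  The integrand increases in \<open>s\<close>, so for \<open>s \<ge> 1\<close> it is at least its value \<open>c > 0\<close> at 1; the
  integral therefore grows at least linearly and attains every nonnegative value.
\<close>

lemma profile_integral_surj:
  assumes "y \<ge> 0"
  shows "\<exists>x\<ge>0. profile_integral p \<gamma> x = y"
proof -
  define c where "c = (1 + 1 / (\<gamma> - 1)) powr (- 1 / p)"
  have "1 + 1 / (\<gamma> - 1) > 0" using \<gamma> by (intro add_pos_nonneg) auto
  then have "c > 0" by (simp add: c_def)
  have d: "((\<lambda>x. y - profile_integral p \<gamma> x) has_real_derivative
          - ((1 + x powr (1 - \<gamma>) / (\<gamma> - 1)) powr (- 1 / p))) (at x)" if "x \<ge> 1" for x
    using profile_integral_deriv[of x] that by (auto intro!: derivative_eq_intros)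
  have "- ((1 + x powr (1 - \<gamma>) / (\<gamma> - 1)) powr (- 1 / p)) \<le> - c" if "x \<ge> 1" for x
  proof -
    have "x powr (1 - \<gamma>) \<le> 1" using powr_mono[of "1 - \<gamma>" 0 x] that \<gamma> by simp
    then show ?thesis unfolding c_def neg_le_iff_le
      using p \<gamma> by (intro powr_mono2' add_pos_nonneg add_left_mono divide_right_mono) auto
  qed
  then obtain b where b: "b \<ge> 1" "y - profile_integral p \<gamma> b < 0"
    using eventually_neg_of_deriv_bounded_away[OF d _ \<open>c > 0\<close>] by blast
  then have "\<exists>x\<ge>0. x \<le> b \<and> profile_integral p \<gamma> x = y"
    using assms by (intro IVT') (auto simp: profile_integral_0
        intro: continuous_on_subset[OF continuous_profile_integral])
  then show ?thesis by blast
qed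

lemma ex_profile: "\<exists>v1. is_v1 p \<gamma> v1"
proof -
  have "\<forall>t. \<exists>x. t \<ge> 0 \<longrightarrow> x \<ge> 0 \<and> profile_integral p \<gamma> x = (p / (p - 1)) powr (1 / p) * t"
    using profile_integral_surj by (metis mult_nonneg_nonneg powr_ge_zero)
  then show ?thesis
    unfolding is_v1_def profile_integral_def[symmetric] by metis
qed

lemma profile_unique:
  assumes "is_v1 p \<gamma> v1" "t \<ge> 0" "x \<ge> 0"
    "profile_integral p \<gamma> x = (p / (p - 1)) powr (1 / p) * t"
  shows "x = v1 t"
proof (rule inj_onD[OF strict_mono_on_imp_inj_on[OF profile_integral_strict_mono]])
  show "profile_integral p \<gamma> x = profile_integral p \<gamma> (v1 t)" "v1 t \<in> {0..}"
    using assms by (simp_all add: is_v1_def profile_integral_def)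
qed (use assms in simp)

section \<open>Integration of the first-order equation\<close>

text \<open>
  For \<open>C = 0\<close> the equation reads \<open>v' = B powr (1 / p) * v powr ((1 - \<gamma>) / p)\<close> with \<open>B\<close> as
  in the proof, so \<open>v powr ((\<gamma> + p - 1) / p)\<close> has the constant derivative \<open>K\<close>.
\<close>

lemma zero_energy_solution:
  fixes v :: "real \<Rightarrow> real"
  assumes cont: "continuous_on {0..} v" and pos: "\<And>t. t > 0 \<Longrightarrow> v t > 0" and "v 0 = 0"
    and ode: "\<And>t. t > 0 \<Longrightarrow>
      (v has_real_derivative (p / (p - 1) * (v t powr (1 - \<gamma>) / (\<gamma> - 1))) powr (1 / p)) (at t)"
    and "t \<ge> 0"
  shows "v t = v0 p \<gamma> t"
proof -
  define q where "q = \<gamma> + p - 1"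
  have q: "q > 0" "q / p - 1 = (\<gamma> - 1) / p" using p \<gamma> by (auto simp: q_def field_simps)
  define B where "B = p / ((p - 1) * (\<gamma> - 1))"
  have "B > 0" using p \<gamma> by (simp add: B_def)
  define K where "K = q / p * B powr (1 / p)"
  have "K > 0" using q p \<open>B > 0\<close> by (simp add: K_def)
  have nonneg: "v x \<ge> 0" if "x \<ge> 0" for x
    using pos[of x] \<open>v 0 = 0\<close> that by (cases "x = 0") (auto simp: less_imp_le)
  have "v t powr (q / p) = K * t"
  proof (rule linear_of_constant_derivative[OF _ _ _ \<open>t \<ge> 0\<close>])
    show "continuous_on {0..} (\<lambda>t. v t powr (q / p))"
      using q p nonneg by (intro continuous_on_powr' cont) (auto intro!: continuous_intros)
    fix x :: real assume "x > 0"
    have "(p / (p - 1) * (v x powr (1 - \<gamma>) / (\<gamma> - 1))) powr (1 / p) =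
        B powr (1 / p) * v x powr ((1 - \<gamma>) / p)"
    proof -
      have "p / (p - 1) * (v x powr (1 - \<gamma>) / (\<gamma> - 1)) = B * v x powr (1 - \<gamma>)"
        by (simp add: B_def)
      then show ?thesis using \<open>B > 0\<close> by (simp add: powr_mult powr_powr)
    qed
    moreover have "v x powr ((\<gamma> - 1) / p) * v x powr ((1 - \<gamma>) / p) = 1"
      using pos[OF \<open>x > 0\<close>] p by (simp flip: powr_add add: diff_divide_distrib)
    ultimately have "q / p * v x powr (q / p - 1) *
        (p / (p - 1) * (v x powr (1 - \<gamma>) / (\<gamma> - 1))) powr (1 / p) = K"
      unfolding q K_def by (simp add: mult.left_commute)
    then show "((\<lambda>t. v t powr (q / p)) has_real_derivative K) (at x)"
      using DERIV_chain2[OF has_real_derivative_powr[OF pos[OF \<open>x > 0\<close>]] ode[OF \<open>x > 0\<close>], of "q / p"]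
      by simp
  qed (use \<open>v 0 = 0\<close> in simp)
  moreover have "(v t powr (q / p)) powr (p / q) = v t"
    using q p nonneg[OF \<open>t \<ge> 0\<close>] by (simp add: powr_powr)
  ultimately have "(K * t) powr (p / q) = v t" by simp
  moreover have "K powr p = q powr p / (p powr (p - 1) * (p - 1) * (\<gamma> - 1))"
  proof -
    have "K powr p = q powr p / p powr p * B"
      using q p \<open>B > 0\<close> by (simp add: K_def powr_mult powr_divide powr_powr)
    also have "p powr p = p * p powr (p - 1)" using p by (simp add: powr_mult_base)
    finally show ?thesis using p by (simp add: B_def)
  qed
  moreover have "(K * t) powr (p / q) = (K powr p) powr (1 / q) * t powr (p / q)"
    using \<open>K > 0\<close> \<open>t \<ge> 0\<close> by (simp add: powr_mult powr_powr)
  ultimately show ?thesis by (simp add: v0_def q_def)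
qed

text \<open>
  The rescaled function \<open>A * v t\<close> with \<open>A = \<mu> powr (p / (\<gamma> + p - 1))\<close> should satisfy the
  defining equation of \<open>v1\<close> at \<open>\<mu> * t\<close>. Differentiating that equation shows what \<open>\<mu>\<close> must be:
  \<open>A powr (1 - \<gamma>) = 1 / C\<close> turns \<open>1 + (A * v) powr (1 - \<gamma>) / (\<gamma> - 1)\<close> into
  \<open>(C + v powr (1 - \<gamma>) / (\<gamma> - 1)) / C\<close>, which cancels against the power in \<open>v'\<close>, and then
  \<open>C powr (1 / p) * A = \<mu>\<close> makes the slope equal to that of the defining equation. Both
  conditions hold for the \<open>\<mu>\<close> chosen in the proof.
\<close>

lemma positive_energy_solution:
  fixes v :: "real \<Rightarrow> real" and C :: real
  assumes cont: "continuous_on {0..} v" and pos: "\<And>t. t > 0 \<Longrightarrow> v t > 0" and "v 0 = 0" and "C > 0"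
    and ode: "\<And>t. t > 0 \<Longrightarrow>
      (v has_real_derivative (p / (p - 1) * (C + v t powr (1 - \<gamma>) / (\<gamma> - 1))) powr (1 / p)) (at t)"
    and v1: "is_v1 p \<gamma> v1"
  shows "\<exists>\<mu>>0. \<forall>t\<ge>0. v t = \<mu> powr (- (p / (\<gamma> + p - 1))) * v1 (\<mu> * t)"
proof -
  define q where "q = \<gamma> + p - 1"
  have q: "q > 0" using p \<gamma> by (simp add: q_def)
  define \<mu> where "\<mu> = C powr (q / (p * (\<gamma> - 1)))"
  have "\<mu> > 0" using \<open>C > 0\<close> by (simp add: \<mu>_def)
  define A where "A = \<mu> powr (p / q)"
  have A: "A = C powr (1 / (\<gamma> - 1))"
    using q p \<gamma> by (simp add: A_def \<mu>_def powr_powr)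
  have "A > 0" using \<open>C > 0\<close> by (simp add: A)
  have A1: "A powr (1 - \<gamma>) = 1 / C"
  proof -
    have "1 / (\<gamma> - 1) * (1 - \<gamma>) = - 1" using \<gamma> by (simp add: field_simps)
    then have "A powr (1 - \<gamma>) = C powr - 1" unfolding A powr_powr by simp
    then show ?thesis using \<open>C > 0\<close> by (simp add: powr_minus_divide)
  qed
  have A2: "C powr (1 / p) * A = \<mu>"
  proof -
    have "1 / p + 1 / (\<gamma> - 1) = q / (p * (\<gamma> - 1))" using p \<gamma> by (simp add: q_def field_simps)
    then show ?thesis unfolding A \<mu>_def by (simp flip: powr_add)
  qed
  define \<kappa> where "\<kappa> = (p / (p - 1)) powr (1 / p)"
  have nonneg: "v x \<ge> 0" if "x \<ge> 0" for x
    using pos[of x] \<open>v 0 = 0\<close> that by (cases "x = 0") (auto simp: less_imp_le)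
  have lin: "profile_integral p \<gamma> (A * v t) = (\<kappa> * \<mu>) * t" if "t \<ge> 0" for t
  proof (rule linear_of_constant_derivative[OF _ _ _ that])
    show "continuous_on {0..} (\<lambda>t. profile_integral p \<gamma> (A * v t))"
    proof (rule continuous_on_compose2[OF continuous_profile_integral])
      show "continuous_on {0..} (\<lambda>t. A * v t)" by (intro continuous_on_mult_left cont)
      show "(\<lambda>t. A * v t) ` {0..} \<subseteq> {0..}"
      proof (rule image_subsetI)
        fix x :: real assume "x \<in> {0..}"
        then have "v x \<ge> 0" using nonneg by simp
        then show "A * v x \<in> {0..}" using \<open>A > 0\<close> by simp
      qed
    qed
    fix x :: real assume "x > 0"
    define X where "X = C + v x powr (1 - \<gamma>) / (\<gamma> - 1)"
    have "X > 0" using \<open>C > 0\<close> \<gamma> by (auto simp: X_def intro!: add_pos_nonneg)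
    have eq1: "1 + (A * v x) powr (1 - \<gamma>) / (\<gamma> - 1) = X / C"
      using \<open>A > 0\<close> pos[OF \<open>x > 0\<close>] \<open>C > 0\<close>
      by (simp add: X_def powr_mult A1 add_divide_distrib mult.commute)
    have eq2: "(X / C) powr (- 1 / p) * X powr (1 / p) = C powr (1 / p)"
    proof -
      have "(X / C) powr (- 1 / p) = inverse (X powr (1 / p) / C powr (1 / p))"
        using \<open>X > 0\<close> \<open>C > 0\<close> powr_minus[of "X / C" "1 / p"] by (simp add: powr_divide)
      then show ?thesis using \<open>X > 0\<close> by simp
    qed
    have eq3: "(p / (p - 1) * X) powr (1 / p) = \<kappa> * X powr (1 / p)"
      unfolding \<kappa>_def by (rule powr_mult)
    have "(X / C) powr (- 1 / p) * (A * (p / (p - 1) * X) powr (1 / p)) =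
        \<kappa> * ((X / C) powr (- 1 / p) * X powr (1 / p) * A)"
      unfolding eq3 by (simp only: mult_ac)
    also have "\<dots> = \<kappa> * \<mu>" unfolding eq2 A2 ..
    finally have slope: "(X / C) powr (- 1 / p) * (A * (p / (p - 1) * X) powr (1 / p)) = \<kappa> * \<mu>" .
    have "((\<lambda>t. A * v t) has_real_derivative A * (p / (p - 1) * X) powr (1 / p)) (at x)"
      unfolding X_def by (rule DERIV_cmult[OF ode[OF \<open>x > 0\<close>]])
    from DERIV_chain2[OF profile_integral_deriv this]
    show "((\<lambda>t. profile_integral p \<gamma> (A * v t)) has_real_derivative \<kappa> * \<mu>) (at x)"
      using \<open>A > 0\<close> pos[OF \<open>x > 0\<close>] unfolding eq1 slope by simp
  qed (simp add: \<open>v 0 = 0\<close> profile_integral_0)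
  have "v t = \<mu> powr (- (p / q)) * v1 (\<mu> * t)" if "t \<ge> 0" for t
  proof -
    have "A * v t = v1 (\<mu> * t)"
    proof (rule profile_unique[OF v1])
      show "\<mu> * t \<ge> 0" "A * v t \<ge> 0"
        using that nonneg[OF that] \<open>\<mu> > 0\<close> \<open>A > 0\<close> by simp_all
      show "profile_integral p \<gamma> (A * v t) = (p / (p - 1)) powr (1 / p) * (\<mu> * t)"
        unfolding lin[OF that] \<kappa>_def by (rule mult.assoc)
    qed
    moreover have "\<mu> powr (- (p / q)) = inverse A" unfolding A_def by (rule powr_minus)
    moreover have "v t = inverse A * (A * v t)" using \<open>A > 0\<close> by simp
    ultimately show ?thesis by simp
  qed
  with \<open>\<mu> > 0\<close> show ?thesis unfolding q_def by (intro exI[of _ \<mu>]) simp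
qed

end

theorem theorem10:
  fixes p \<gamma> \<alpha> :: real
  assumes "p > 1" and "0 < \<alpha>" and "\<alpha> < 1"
  shows "(\<gamma> > 1 \<longrightarrow>
            (\<exists>v1. is_v1 p \<gamma> v1 \<and>
                  (\<forall>w. is_v1 p \<gamma> w \<longrightarrow> (\<forall>t\<ge>0. w t = v1 t)) \<and>
                  (\<forall>v. singular_solution \<alpha> p \<gamma> v \<longrightarrow>
                     (\<forall>t\<ge>0. v t = v0 p \<gamma> t) \<or>
                     (\<exists>\<mu>>0. \<forall>t\<ge>0. v t = \<mu> powr (- (p / (\<gamma> + p - 1))) * v1 (\<mu> * t))))) \<and>
         (0 < \<gamma> \<and> \<gamma> \<le> 1 \<longrightarrow> (\<nexists>v. singular_solution \<alpha> p \<gamma> v))"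
proof (intro conjI impI)
  assume \<gamma>: "\<gamma> > 1"
  obtain v1 where v1: "is_v1 p \<gamma> v1" using ex_profile[OF \<open>p > 1\<close> \<gamma>] by blast
  have unique: "w t = v1 t" if "is_v1 p \<gamma> w" "t \<ge> 0" for w t
    using profile_unique[OF \<open>p > 1\<close> \<gamma> v1, of t "w t"] that
    by (simp add: is_v1_def profile_integral_def)
  have "(\<forall>t\<ge>0. v t = v0 p \<gamma> t) \<or>
      (\<exists>\<mu>>0. \<forall>t\<ge>0. v t = \<mu> powr (- (p / (\<gamma> + p - 1))) * v1 (\<mu> * t))"
    if sol: "singular_solution \<alpha> p \<gamma> v" for v
  proof -
    have "\<gamma> > 0" using \<gamma> by simp
    note facts = \<open>p > 1\<close> \<open>\<gamma> > 0\<close> sol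
    obtain C where C: "C \<ge> 0" "\<And>t. t > 0 \<Longrightarrow>
        deriv v t = (p / (p - 1) * (C + v t powr (1 - \<gamma>) / (\<gamma> - 1))) powr (1 / p)"
      using first_order_equation[OF facts \<gamma>] by blast
    have ode: "(v has_real_derivative
        (p / (p - 1) * (C + v t powr (1 - \<gamma>) / (\<gamma> - 1))) powr (1 / p)) (at t)" if "t > 0" for t
      using solution_deriv[OF facts that] C(2)[OF that] by simp
    have v: "continuous_on {0..} v" "\<And>t. t > 0 \<Longrightarrow> v t > 0" "v 0 = 0"
      using sol by (auto simp: singular_solution_def)
    show ?thesis
    proof (cases "C = 0")
      case True
      then show ?thesis using zero_energy_solution[OF \<open>p > 1\<close> \<gamma> v] ode by simp
    next
      case False
      then show ?thesis
        using positive_energy_solution[OF \<open>p > 1\<close> \<gamma> v _ ode v1] C(1) by simp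
    qed
  qed
  then show "\<exists>v1. is_v1 p \<gamma> v1 \<and> (\<forall>w. is_v1 p \<gamma> w \<longrightarrow> (\<forall>t\<ge>0. w t = v1 t)) \<and>
      (\<forall>v. singular_solution \<alpha> p \<gamma> v \<longrightarrow> (\<forall>t\<ge>0. v t = v0 p \<gamma> t) \<or>
        (\<exists>\<mu>>0. \<forall>t\<ge>0. v t = \<mu> powr (- (p / (\<gamma> + p - 1))) * v1 (\<mu> * t)))"
    using v1 unique by blast
next
  assume "0 < \<gamma> \<and> \<gamma> \<le> 1"
  then show "\<nexists>v. singular_solution \<alpha> p \<gamma> v"
    using no_solution_of_exponent_le_1[OF \<open>p > 1\<close>] by blast
qed

end
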